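(* Let $q$ be a power of an odd prime. Let $A(t)\in\mathbb{F}_q[t]$ be squarefree of odd degree $d>1$, splitting completely over $\mathbb{F}_q$, with derivative $A'(t)=\gamma\in\mathbb{F}_q^*$ a nonzero constant. Let $f(x)\in\mathbb{F}_q[x]$ be a monic cubic with distinct roots. Suppose $F(t),G(t)\in\mathbb{F}_q[t]$ satisfy $A(t)G(t)^2=f(F(t))$ and $F'(t)\neq0$. Then the following are equivalent: (A) $2\deg F\le d-1$; (B) $2\deg G\le \deg F-1$; (C) $G(t)^2=\beta F'(t)$ for some $\beta\in\mathbb{F}_q^*$. Moreover, if one of these holds, then the elliptic curve $y^2=f(x)$ is isomorphic over $\mathbb{F}_q$ to $ay^2=x^3-x$ for some $a\in\mathbb{F}_q^*$.
   Context: $F'$ denotes the formal derivative with respect to $t$. *)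

theory Defs
  imports "HOL-Algebra.Algebraic_Closure_Type"
begin

definition splits_completely :: "'a::field poly \<Rightarrow> bool" where
  "splits_completely p \<longleftrightarrow>
     (\<exists>xs. p = Polynomial.smult (Polynomial.lead_coeff p) (\<Prod>x\<leftarrow>xs. [:- x, 1:]))"

text \<open>The roots are taken in the algebraic closure; f need not split over the base field.\<close>

definition distinct_roots :: "'a::field poly \<Rightarrow> bool" where
  "distinct_roots f \<longleftrightarrow>
     card {r :: 'a alg_closure. poly (map_poly to_ac f) r = 0} = Polynomial.degree f"


text \<open>
  Projective plane curves over a field K are represented by their sets of points over the
  algebraic closure of K. A point of the projective plane is the set of all its homogeneous
  coordinate vectors. For the zero vector, \<open>proj_point\<close> is a junk value.
\<close>

type_synonym 'a pt = "('a alg_closure \<times> 'a alg_closure \<times> 'a alg_closure) set"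

definition proj_point ::
  "'a alg_closure \<times> 'a alg_closure \<times> 'a alg_closure \<Rightarrow> 'a::field pt" where
  "proj_point v = (case v of (x, y, z) \<Rightarrow> {(c * x, c * y, c * z) | c. c \<noteq> 0})"

text \<open>
  The homogeneous polynomial of degree n over K in which the monomial
  \<open>X^i Y^j Z^(n-i-j)\<close> has coefficient \<open>c i j\<close>, evaluated over the algebraic closure.
\<close>

definition eval_form ::
  "nat \<Rightarrow> (nat \<Rightarrow> nat \<Rightarrow> 'a::field) \<Rightarrow>
     'a alg_closure \<times> 'a alg_closure \<times> 'a alg_closure \<Rightarrow> 'a alg_closure" where
  "eval_form n c v = (case v of (x, y, z) \<Rightarrow>
     \<Sum>i\<le>n. \<Sum>j\<le>n - i. to_ac (c i j) * x ^ i * y ^ j * z ^ (n - i - j))"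

definition eval_forms ::
  "nat \<Rightarrow> (nat \<Rightarrow> nat \<Rightarrow> 'a::field) \<Rightarrow> (nat \<Rightarrow> nat \<Rightarrow> 'a) \<Rightarrow> (nat \<Rightarrow> nat \<Rightarrow> 'a) \<Rightarrow>
     'a alg_closure \<times> 'a alg_closure \<times> 'a alg_closure \<Rightarrow>
     'a alg_closure \<times> 'a alg_closure \<times> 'a alg_closure" where
  "eval_forms n c0 c1 c2 v = (eval_form n c0 v, eval_form n c1 v, eval_form n c2 v)"

text \<open>
  The projective closure of the affine curve \<open>b y^2 = f(x)\<close> for a cubic f, that is,
  \<open>b Y^2 Z = Z^3 f(X/Z)\<close>, and its distinguished point \<open>[0 : 1 : 0]\<close> at infinity.
\<close>

definition curve :: "'a::field \<Rightarrow> 'a poly \<Rightarrow> 'a pt set" where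
  "curve b f = {proj_point (x, y, z) | x y z. (x, y, z) \<noteq> (0, 0, 0) \<and>
     to_ac b * y ^ 2 * z = (\<Sum>i\<le>3. to_ac (Polynomial.coeff f i) * x ^ i * z ^ (3 - i))}"

definition point_at_infinity :: "'a::field pt" where
  "point_at_infinity = proj_point (0, 1, 0)"

text \<open>
  A morphism over K is a map on points that near each point is given by three forms over K
  of equal degree that have no common zero at that point.
\<close>

definition is_morphism :: "'a::field pt set \<Rightarrow> 'a pt set \<Rightarrow> ('a pt \<Rightarrow> 'a pt) \<Rightarrow> bool" where
  "is_morphism S T \<phi> \<longleftrightarrow> \<phi> ` S \<subseteq> T \<and>
     (\<forall>u. u \<noteq> (0, 0, 0) \<and> proj_point u \<in> S \<longrightarrow>
        (\<exists>n c0 c1 c2. eval_forms n c0 c1 c2 u \<noteq> (0, 0, 0) \<and>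
           (\<forall>v. v \<noteq> (0, 0, 0) \<and> proj_point v \<in> S \<and> eval_forms n c0 c1 c2 v \<noteq> (0, 0, 0) \<longrightarrow>
              \<phi> (proj_point v) = proj_point (eval_forms n c0 c1 c2 v))))"

text \<open>
  Isomorphism over K of the elliptic curves \<open>b y^2 = f(x)\<close> and \<open>b' y^2 = f'(x)\<close>, each with
  base point at infinity.
\<close>

definition ell_isomorphic :: "'a::field \<Rightarrow> 'a poly \<Rightarrow> 'a \<Rightarrow> 'a poly \<Rightarrow> bool" where
  "ell_isomorphic b f b' f' \<longleftrightarrow>
     (\<exists>\<phi> \<psi>. is_morphism (curve b f) (curve b' f') \<phi> \<and>
        is_morphism (curve b' f') (curve b f) \<psi> \<and>
        (\<forall>P \<in> curve b f. \<psi> (\<phi> P) = P) \<and> (\<forall>Q \<in> curve b' f'. \<phi> (\<psi> Q) = Q) \<and>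
        \<phi> point_at_infinity = point_at_infinity)"

end

(*
  Conditions (A) and (B) are equivalent by comparing degrees, and (C) implies (B) because
  2 deg G = deg F' < deg F.  For the converse, differentiating A G^2 = f(F) gives
  gamma G^2 + 2 A G G' = f'(F) F'.  Since f is separable, G divides F', say F' = G H, and
  gamma G = f'(F) H at every root of A.  The values of F at the d roots of A are roots of f;
  as d > 2 deg F, all three roots e of f occur, and they are rational.  The product over e of
  gamma G - f'(e) H vanishes at the d roots of A but has degree less than d, so
  gamma G = f'(e) H for some e, which is (C).  If f' took the value f'(e) at no other root of f,
  then H would vanish at all roots of A with F-value different from e, so that
  d <= deg F + deg H, which is too small.  Hence f'(e) = f'(e') for another root e', and the third
  root m is the midpoint of e and e'; x -> (x - m) / (e - m) turns f into a multiple of x^3 - x.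
*)

theory Submission
  imports Defs
begin

section \<open>Degrees, root counts and Bezout relations over a field\<close>

lemma degree_pderiv_le_diff_1:
  "Polynomial.degree (pderiv p) \<le> Polynomial.degree p - 1"
  by (rule degree_le) (auto simp: coeff_pderiv coeff_eq_0)

text \<open>A non-zero derivative excludes constants. In positive characteristic the degree can drop
  by more than one, so an inequality is the most that holds.\<close>

lemma degree_less_if_pderiv_neq_0:
  assumes "pderiv p \<noteq> 0"
  shows "Polynomial.degree (pderiv p) < Polynomial.degree p"
proof -
  have "Polynomial.degree p \<noteq> 0"
    using assms by (metis degree_eq_zeroE pderiv_singleton)
  then show ?thesis
    using degree_pderiv_le_diff_1[of p] by linarith
qed

lemma card_le_degree_if_roots:
  fixes P :: "'a::field poly"
  assumes "P \<noteq> 0" and "\<And>x. x \<in> V \<Longrightarrow> poly P x = 0"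
  shows "card V \<le> Polynomial.degree P"
proof -
  have "card V \<le> card {x. poly P x = 0}"
    using assms by (intro card_mono poly_roots_finite) auto
  then show ?thesis
    using card_poly_roots_bound[OF assms(1)] by linarith
qed

lemma card_fibre_le_degree:
  fixes P :: "'a::field poly"
  assumes "Polynomial.degree P > 0"
  shows "card {x \<in> V. poly P x = c} \<le> Polynomial.degree P"
proof -
  have deg: "Polynomial.degree (P - [:c:]) = Polynomial.degree P"
    using assms by (simp add: degree_add_eq_left diff_conv_add_uminus del: add_uminus_conv_diff)
  then have "P - [:c:] \<noteq> 0"
    using assms by (metis degree_0 less_irrefl)
  then have "card {x \<in> V. poly P x = c} \<le> Polynomial.degree (P - [:c:])"
    by (rule card_le_degree_if_roots) simp
  then show ?thesis
    using deg by simp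
qed

text \<open>A repeated entry \<open>y\<close> in the list of roots would make the square of
  \<open>[:- y, 1:]\<close> divide \<open>A\<close>. So the list is distinct, and its length is both
  the degree and the number of roots.\<close>

lemma card_roots_eq_degree:
  fixes A :: "'a::field poly"
  assumes "splits_completely A" and "squarefree A"
  shows "card {x. poly A x = 0} = Polynomial.degree A"
proof -
  have A0: "A \<noteq> 0"
    using assms(2) by auto
  obtain xs where xs:
    "A = Polynomial.smult (Polynomial.lead_coeff A) (\<Prod>x\<leftarrow>xs. [:- x, 1:])"
    using assms(1) unfolding splits_completely_def by blast
  have "distinct xs"
  proof (rule ccontr)
    assume "\<not> distinct xs"
    then obtain us vs ws y where "xs = us @ [y] @ vs @ [y] @ ws"
      using not_distinct_decomp by blast
    then have "(\<Prod>x\<leftarrow>xs. [:- x, 1:]) =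
        [:- y, 1:] ^ 2 * ((\<Prod>x\<leftarrow>us. [:- x, 1:]) * (\<Prod>x\<leftarrow>vs. [:- x, 1:]) * (\<Prod>x\<leftarrow>ws. [:- x, 1:]))"
      by (simp only: map_append prod_list.append list.map prod_list.Cons prod_list.Nil
          power2_eq_square mult_1_right mult.assoc mult.left_commute)
    then have "[:- y, 1:] ^ 2 dvd A"
      using xs dvd_smult dvd_triv_left by metis
    then have "[:- y, 1:] dvd 1"
      using assms(2) squarefreeD by blast
    then show False
      by (simp add: is_unit_iff_degree)
  qed
  moreover have "{x. poly A x = 0} = set xs"
  proof -
    have "poly (\<Prod>x\<leftarrow>ys. [:- x, 1::'a:]) z = 0 \<longleftrightarrow> z \<in> set ys" for ys z
      by (induction ys) (simp_all del: mult_pCons_left)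
    then show ?thesis
      using A0 by (subst xs) simp
  qed
  moreover have "Polynomial.degree A = length xs"
  proof -
    have "Polynomial.degree (\<Prod>x\<leftarrow>ys. [:- x, 1::'a:]) = length ys" for ys
      by (induction ys) (simp_all add: degree_mult_eq prod_list_zero_iff image_iff del: mult_pCons_left)
    then show ?thesis
      using A0 by (subst xs) simp
  qed
  ultimately show ?thesis
    by (simp add: distinct_card)
qed

text \<open>Both sides vanish on \<open>S\<close> and are monic of degree \<open>card S\<close>, so
  their difference has degree below \<open>card S\<close> unless it is zero, yet it has
  \<open>card S\<close> roots.\<close>

lemma monic_eq_prod_roots:
  fixes f :: "'a::field poly"
  assumes "finite S" and "\<And>e. e \<in> S \<Longrightarrow> poly f e = 0"
    and "Polynomial.lead_coeff f = 1" and "Polynomial.degree f = card S"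
  shows "f = (\<Prod>e\<in>S. [:- e, 1:])"
proof (rule poly_eqI_degree_lead_coeff[where A = S and n = "card S"])
  have deg: "Polynomial.degree (\<Prod>e\<in>S. [:- e, 1:]) = card S"
    by (subst degree_prod_eq_sum_degree) auto
  then show "Polynomial.degree (\<Prod>e\<in>S. [:- e, 1:]) \<le> card S"
    by simp
  have "Polynomial.lead_coeff (\<Prod>e\<in>S. [:- e, 1:]) = 1"
    by (simp add: lead_coeff_prod)
  then show "poly.coeff f (card S) = poly.coeff (\<Prod>e\<in>S. [:- e, 1:]) (card S)"
    using assms(3,4) deg by simp
  show "poly f z = poly (\<Prod>e\<in>S. [:- e, 1:]) z" if "z \<in> S" for z
  proof -
    have "(\<Prod>e\<in>S. z - e) = 0"
      using that assms(1) by (intro prod_zero) auto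
    then show ?thesis
      using assms(2)[OF that] by (simp add: poly_prod)
  qed
qed (use assms in auto)

text \<open>A linear factor is comaximal with \<open>R\<close> because \<open>R\<close> is congruent
  to the non-zero constant \<open>poly R e\<close> modulo it, and comaximality with \<open>R\<close>
  passes to products. An explicit Bezout relation is wanted because it survives substituting
  \<open>F\<close> for the variable.\<close>

lemma comaximal_prod_linear:
  fixes R :: "'a::field poly"
  assumes "finite S" and "\<And>e. e \<in> S \<Longrightarrow> poly R e \<noteq> 0"
  shows "\<exists>u v. u * (\<Prod>e\<in>S. [:- e, 1:]) + v * R = 1"
  using assms
proof (induction S)
  case empty
  have "1 * (\<Prod>e\<in>{}. [:- e, 1:]) + 0 * R = 1"
    by simp
  then show ?case
    by blast
next
  case (insert e S)
  then obtain u v where uv: "u * (\<Prod>e\<in>S. [:- e, 1:]) + v * R = 1"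
    by auto
  let ?c = "poly R e"
  have c: "?c \<noteq> 0"
    using insert.prems by simp
  have "poly (R - [:?c:]) e = 0"
    by simp
  then obtain K where "R - [:?c:] = [:- e, 1:] * K"
    by (metis dvdE poly_eq_0_iff_dvd)
  then have R: "R - [:- e, 1:] * K = [:?c:]"
    by (simp add: algebra_simps)
  define b L P where "b = [:inverse ?c:]" and "L = [:- e, 1:]" and "P = (\<Prod>e\<in>S. [:- e, 1:])"
  have "b * (R - L * K) = 1"
    unfolding b_def L_def R using c by (simp add: one_pCons)
  then have "(- b * K) * L + b * R = 1"
    by (simp add: algebra_simps)
  moreover define a where "a = - b * K"
  moreover have "u * P + v * R = 1"
    using uv unfolding P_def .
  ultimately have "a * L + b * R = 1" "u * P + v * R = 1"
    by auto
  \<comment> \<open>Multiplying the two relations leaves one term in \<open>L * P\<close>; every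
    other term contains \<open>R\<close>.\<close>
  then have "(a * L + b * R) * (u * P + v * R) = 1"
    by simp
  then have "(a * u) * (L * P) + (a * L * v + b * (u * P + v * R)) * R = 1"
    by (simp add: algebra_simps)
  then show ?case
    using insert.hyps unfolding L_def P_def by auto
qed

section \<open>From the degree bound (A) to (C) and to a cubic with equally spaced roots\<close>

lemma square_eq_smult_pderiv_and_symmetric_cubic:
  fixes A F G f :: "'a::field poly"
  assumes cardA: "card {x. poly A x = 0} = Polynomial.degree A"
    and dA: "pderiv A = [:\<gamma>:]" and g0: "\<gamma> \<noteq> 0"
    and lc: "Polynomial.lead_coeff f = 1" and deg_f: "Polynomial.degree f = 3"
    and eq: "A * G ^ 2 = pcompose f F"
    and F': "pderiv F \<noteq> 0"
    and condA: "2 * Polynomial.degree F < Polynomial.degree A"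
  obtains \<beta> m s where "\<beta> \<noteq> 0" and "G ^ 2 = Polynomial.smult \<beta> (pderiv F)"
    and "s \<noteq> 0" and "f = [:- m, 1:] * [:- (m + s), 1:] * [:- (m - s), 1:]"
proof -
  define d n g where "d = Polynomial.degree A" and "n = Polynomial.degree F"
    and "g = Polynomial.degree G"
  define R where "R = {x. poly A x = 0}"
  define S where "S = poly F ` R"
  have n0: "Polynomial.degree (pderiv F) < n"
    using degree_less_if_pderiv_neq_0[OF F'] n_def by simp
  have f0: "f \<noteq> 0"
    using lc by auto
  have A0: "A \<noteq> 0"
    using condA by auto
  have deg_fF: "Polynomial.degree (pcompose f F) = 3 * n"
    by (simp add: degree_pcompose deg_f n_def)
  then have fF0: "pcompose f F \<noteq> 0"
    using n0 by auto
  then have G0: "G \<noteq> 0"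
    using eq by auto
  have degs: "d + 2 * g = 3 * n"
    using deg_fF eq A0 G0 unfolding d_def g_def
    by (metis degree_mult_eq degree_power_eq power_not_zero)
  have finR: "finite R"
    unfolding R_def using A0 by (rule poly_roots_finite)
  have finS: "finite S"
    unfolding S_def using finR by simp
  have rootS: "poly f e = 0" if "e \<in> S" for e
    using that arg_cong[OF eq, of "\<lambda>p. poly p _"] unfolding S_def R_def
    by (auto simp: poly_pcompose) (metis mult_zero_left)
  have cardS: "card S = 3"
  proof -
    have "card S \<le> 3"
      using card_le_degree_if_roots[OF f0 rootS] deg_f by simp
    moreover have "R = (\<Union>e\<in>S. {x \<in> R. poly F x = e})"
      unfolding S_def by auto
    then have "card R \<le> (\<Sum>e\<in>S. card {x \<in> R. poly F x = e})"
      using card_UN_le[OF finS] by metis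
    \<comment> \<open>Each fibre of \<open>F\<close> has at most \<open>n\<close> points, so d > 2n
      leaves no room for only two values.\<close>
    then have "d \<le> (\<Sum>e\<in>S. n)"
      using sum_mono[of S "\<lambda>e. card {x \<in> R. poly F x = e}" "\<lambda>e. n"]
        card_fibre_le_degree[of F R] n0 cardA
      unfolding n_def d_def R_def by fastforce
    then have "d \<le> card S * n"
      by simp
    then have "\<not> card S \<le> 2"
      using condA mult_le_mono1[of "card S" 2 n] unfolding n_def d_def by linarith
    ultimately show ?thesis
      by simp
  qed
  have f_prod: "f = (\<Prod>e\<in>S. [:- e, 1:])"
    using finS rootS lc deg_f cardS by (intro monic_eq_prod_roots) auto
  \<comment> \<open>Stated for any ordering of the roots, so that the derivative at a chosen root is
    read off by listing that root first.\<close>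
  have f_three: "f = [:- a, 1:] * [:- b, 1:] * [:- c, 1:] \<and>
      poly (pderiv f) a = (a - b) * (a - c)"
    if "S = {a, b, c}" "a \<noteq> b" "a \<noteq> c" "b \<noteq> c" for a b c
  proof -
    have f: "f = [:- a, 1:] * [:- b, 1:] * [:- c, 1:]"
      unfolding f_prod that(1) using that(2-4) by (simp del: mult_pCons_left mult_pCons_right)
    show ?thesis
      unfolding f by (simp add: pderiv_mult pderiv_pCons algebra_simps)
  qed
  have f'_neq_0: "poly (pderiv f) e \<noteq> 0" if "e \<in> S" for e
  proof -
    have "card (S - {e}) = 2"
      using cardS finS that by simp
    then obtain b c where bc: "S - {e} = {b, c}" "b \<noteq> c"
      by (meson card_2_iff)
    then have "S = {e, b, c}" "e \<noteq> b" "e \<noteq> c"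
      using that by auto
    then show ?thesis
      using f_three[of e b c] bc by auto
  qed
  define D where "D = pcompose (pderiv f) F"
  have deriv: "[:\<gamma>:] * G ^ 2 + 2 * A * G * pderiv G = D * pderiv F"
  proof -
    have "pderiv (A * G ^ 2) = D * pderiv F"
      unfolding eq D_def by (rule pderiv_pcompose)
    then show ?thesis
      by (simp add: pderiv_mult dA power2_eq_square algebra_simps)
  qed
  have "G dvd pderiv F"
  proof -
    obtain u v where "u * f + v * pderiv f = 1"
      using comaximal_prod_linear[OF finS f'_neq_0] f_prod by auto
    \<comment> \<open>Substituting \<open>F\<close> turns \<open>f\<close> into
      \<open>A * G ^ 2\<close> and the derivative of \<open>f\<close> into \<open>D\<close>.
      Multiplied by \<open>pderiv F\<close>, both terms become multiples of \<open>G\<close>, the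
      second one by \<open>deriv\<close>.\<close>
    from arg_cong[OF this, of "\<lambda>p. pcompose p F"]
    have "pcompose u F * (A * G ^ 2) + pcompose v F * D = 1"
      by (simp add: pcompose_add pcompose_mult D_def eq pcompose_1)
    then have "pderiv F = pderiv F * (pcompose u F * (A * G ^ 2) + pcompose v F * D)"
      by simp
    also have "\<dots> = G * (pderiv F * pcompose u F * A * G) + pcompose v F * (D * pderiv F)"
      by (simp add: power2_eq_square algebra_simps)
    also have "\<dots> = G * (pderiv F * pcompose u F * A * G) +
        pcompose v F * ([:\<gamma>:] * G ^ 2 + 2 * A * G * pderiv G)"
      using deriv by simp
    also have "\<dots> = G * (pderiv F * pcompose u F * A * G +
        pcompose v F * ([:\<gamma>:] * G + 2 * A * pderiv G))"
      by (simp add: power2_eq_square algebra_simps)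
    finally show ?thesis
      by (metis dvd_triv_left)
  qed
  then obtain H where H: "pderiv F = G * H"
    by (elim dvdE)
  then have H0: "H \<noteq> 0"
    using F' by auto
  have deg_GH: "g + Polynomial.degree H < n"
    using n0 H G0 H0 degree_mult_eq[OF G0 H0] unfolding g_def by simp
  \<comment> \<open>Cancelling one \<open>G\<close> gives a relation whose term in \<open>A\<close>
    disappears at the points of \<open>R\<close>.\<close>
  have "G * ([:\<gamma>:] * G + 2 * A * pderiv G) = G * (D * H)"
    using deriv unfolding H by (simp add: power2_eq_square algebra_simps)
  then have GH: "[:\<gamma>:] * G + 2 * A * pderiv G = D * H"
    using G0 by (metis mult_left_cancel)
  have at_root: "\<gamma> * poly G x = poly (pderiv f) (poly F x) * poly H x" if "x \<in> R" for x
    using arg_cong[OF GH, of "\<lambda>p. poly p x"] that by (simp add: R_def D_def poly_pcompose)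
  define L where "L = (\<lambda>e. Polynomial.smult \<gamma> G - Polynomial.smult (poly (pderiv f) e) H)"
  have "(\<Prod>e\<in>S. L e) = 0"
  proof (rule ccontr)
    assume *: "(\<Prod>e\<in>S. L e) \<noteq> 0"
    have "Polynomial.degree (L e) \<le> max g (Polynomial.degree H)" for e
      unfolding L_def g_def
      by (intro degree_diff_le) (auto intro: order_trans[OF degree_smult_le])
    then have "Polynomial.degree (\<Prod>e\<in>S. L e) \<le> card S * max g (Polynomial.degree H)"
      using degree_prod_sum_le[OF finS, of L]
        sum_bounded_above[of S "Polynomial.degree \<circ> L" "max g (Polynomial.degree H)"]
      by fastforce
    moreover have "card R \<le> Polynomial.degree (\<Prod>e\<in>S. L e)"
    proof (rule card_le_degree_if_roots[OF *])
      fix x assume x: "x \<in> R"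
      then have "poly (L (poly F x)) x = 0"
        using at_root by (simp add: L_def)
      then show "poly (\<Prod>e\<in>S. L e) x = 0"
        using x finS unfolding poly_prod S_def by (intro prod_zero) auto
    qed
    \<comment> \<open>Write h for the degree of \<open>H\<close>; the product has degree at most 3
      max(g, h). From d + 2g = 3n and 2n < d comes 2g < n, hence 3g < d; from g + h < n comes 3h <
      3n - 3g = d - g.\<close>
    ultimately show False
      using cardA cardS degs deg_GH condA unfolding R_def d_def n_def by (auto simp: max_def split: if_splits)
  qed
  then obtain e where e: "e \<in> S" "L e = 0"
    using finS by auto
  let ?c = "poly (pderiv f) e"
  have c0: "?c \<noteq> 0"
    using f'_neq_0 e by blast
  have GcH: "Polynomial.smult \<gamma> G = Polynomial.smult ?c H"
    using e unfolding L_def by simp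
  have "\<exists>e'\<in>S. e' \<noteq> e \<and> poly (pderiv f) e' = ?c"
  proof (rule ccontr)
    assume no: "\<not> ?thesis"
    have "R = {x \<in> R. poly F x = e} \<union> {x \<in> R. poly F x \<noteq> e}"
      by auto
    then have "card R \<le> card {x \<in> R. poly F x = e} + card {x \<in> R. poly F x \<noteq> e}"
      by (metis card_Un_le)
    moreover have "card {x \<in> R. poly F x = e} \<le> n"
      using card_fibre_le_degree[of F R e] n0 n_def by auto
    moreover have "card {x \<in> R. poly F x \<noteq> e} \<le> Polynomial.degree H"
    proof (rule card_le_degree_if_roots[OF H0])
      fix x assume x: "x \<in> {x \<in> R. poly F x \<noteq> e}"
      then have "poly (pderiv f) (poly F x) \<noteq> ?c"
        using no by (auto simp: S_def)
      moreover have "?c * poly H x = \<gamma> * poly G x"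
        using arg_cong[OF GcH, of "\<lambda>p. poly p x"] by simp
      then have "?c * poly H x = poly (pderiv f) (poly F x) * poly H x"
        using at_root x by simp
      ultimately show "poly H x = 0"
        by auto
    qed
    \<comment> \<open>The count gives d \<le> n + deg \<open>H\<close> < 2n, against the degree
      bound.\<close>
    ultimately show False
      using cardA deg_GH condA unfolding R_def d_def n_def by linarith
  qed
  then obtain e' where e': "e' \<in> S" "e' \<noteq> e" "poly (pderiv f) e' = ?c"
    by blast
  have "card (S - {e, e'}) = 1"
    using cardS finS e e' by (simp add: card_Diff_subset)
  then obtain m where m: "S - {e, e'} = {m}"
    by (meson card_1_singletonE)
  then have S: "S = {e, e', m}" "S = {e', e, m}" and m': "m \<noteq> e" "m \<noteq> e'"
    using e e' by auto
  have f: "f = [:- e, 1:] * [:- e', 1:] * [:- m, 1:]" "?c = (e - e') * (e - m)"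
    and c': "?c = (e' - e) * (e' - m)"
    using f_three[of e e' m] f_three[of e' e m] S m' e' by auto
  \<comment> \<open>The two factorisations of the common value \<open>?c\<close> differ by exactly
    this product.\<close>
  have "(e - e') * (e + e' - 2 * m) = 0"
    using f(2) c' by (simp add: algebra_simps)
  then have mid: "e + e' - 2 * m = 0"
    using e'(2) by simp
  \<comment> \<open>Multiplying \<gamma> G = c H by \<open>G\<close> gives \<gamma> G^2 = c F', so
    \<beta> = c / \<gamma>. With s = e - m the outer roots are m + s = e and m - s = e'.\<close>
  show thesis
  proof (rule that)
    show "?c / \<gamma> \<noteq> 0"
      using c0 g0 by simp
    have "G = Polynomial.smult (?c / \<gamma>) H"
      using arg_cong[OF GcH, of "Polynomial.smult (inverse \<gamma>)"] g0 by (simp add: field_simps)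
    then show "G ^ 2 = Polynomial.smult (?c / \<gamma>) (pderiv F)"
      unfolding H power2_eq_square by (metis mult_smult_right)
    show "e - m \<noteq> 0"
      using m' by simp
    have "m - (e - m) = e'"
      using mid by (simp add: algebra_simps)
    then show "f = [:- m, 1:] * [:- (m + (e - m)), 1:] * [:- (m - (e - m)), 1:]"
      unfolding f(1) by (simp add: mult.commute mult.left_commute del: mult_pCons_left mult_pCons_right)
  qed
qed

section \<open>Linear changes of coordinates between plane cubics\<close>

definition linear_form :: "'a::field \<Rightarrow> 'a \<Rightarrow> 'a \<Rightarrow> nat \<Rightarrow> nat \<Rightarrow> 'a" where
  "linear_form a b c i j = (if i = 1 then a else if j = 1 then b else c)"

text \<open>In degree 1 only the exponent pairs (1,0), (0,1) and (0,0) occur, the last one standing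
  for Z; values of \<open>linear_form\<close> at other pairs never enter.\<close>

lemma eval_form_linear_form:
  "eval_form 1 (linear_form a b c) (x, y, z) = to_ac a * x + to_ac b * y + to_ac c * z"
  by (simp add: eval_form_def linear_form_def algebra_simps)

text \<open>Since \<open>T\<close> commutes with scaling, its set image carries a whole class of
  vectors onto a class. This makes \<open>image T\<close> the induced map on projective
  points.\<close>

lemma image_proj_point:
  assumes "\<And>x y z. T (x, y, z) = (to_ac a * x + to_ac b * z, to_ac c * y, to_ac d * z)"
  shows "T ` proj_point v = proj_point (T v)"
proof -
  have "T (k * x, k * y, k * z) = (k * fst (T (x, y, z)), k * fst (snd (T (x, y, z))), k * snd (snd (T (x, y, z))))"
    for k x y z
    by (simp add: assms algebra_simps)
  then show ?thesis
    unfolding proj_point_def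
    by (auto simp: image_iff split: prod.splits) (metis fst_conv snd_conv)+
qed

text \<open>The affine cone over the curve: the equation can be checked on vectors before passing to
  classes.\<close>

definition on_cone ::
  "'a::field \<Rightarrow> 'a poly \<Rightarrow> 'a alg_closure \<times> 'a alg_closure \<times> 'a alg_closure \<Rightarrow> bool" where
  "on_cone b f v = (case v of (x, y, z) \<Rightarrow>
     to_ac b * y ^ 2 * z = (\<Sum>i\<le>3. to_ac (Polynomial.coeff f i) * x ^ i * z ^ (3 - i)))"

lemma curve_eq_image:
  "curve b f = proj_point ` {v. v \<noteq> (0, 0, 0) \<and> on_cone b f v}"
  unfolding curve_def on_cone_def by auto

text \<open>\<open>T\<close> is triangular with non-zero diagonal, so it kills no non-zero vector.
  Hence its three coordinates form a single triple of linear forms over K that serves at every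
  point.\<close>

lemma is_morphism_curve:
  fixes T :: "'a::field alg_closure \<times> 'a alg_closure \<times> 'a alg_closure \<Rightarrow> _"
  assumes T: "\<And>x y z. T (x, y, z) = (to_ac a * x + to_ac b * z, to_ac c * y, to_ac d * z)"
    and nz: "a \<noteq> 0" "c \<noteq> 0" "d \<noteq> 0"
    and cone: "\<And>v. on_cone k f v \<Longrightarrow> on_cone k' f' (T v)"
  shows "is_morphism (curve k f) (curve k' f') (image T)"
proof -
  have ev: "eval_forms 1 (linear_form a 0 b) (linear_form 0 c 0) (linear_form 0 0 d) v = T v" for v
    by (cases v) (simp only: T eval_forms_def eval_form_linear_form, simp)
  have T0: "T u \<noteq> (0, 0, 0)" if "u \<noteq> (0, 0, 0)" for u
    using that nz by (cases u) (auto simp: T)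
  have "image T ` curve k f \<subseteq> curve k' f'"
  proof (rule image_subsetI)
    fix P assume "P \<in> curve k f"
    then obtain v where v: "P = proj_point v" "v \<noteq> (0, 0, 0)" "on_cone k f v"
      unfolding curve_eq_image by blast
    then show "T ` P \<in> curve k' f'"
      unfolding curve_eq_image v(1) image_proj_point[OF T] using T0 cone by blast
  qed
  moreover have "\<exists>n c0 c1 c2. eval_forms n c0 c1 c2 u \<noteq> (0, 0, 0) \<and>
      (\<forall>v. v \<noteq> (0, 0, 0) \<and> proj_point v \<in> curve k f \<and> eval_forms n c0 c1 c2 v \<noteq> (0, 0, 0) \<longrightarrow>
        T ` proj_point v = proj_point (eval_forms n c0 c1 c2 v))"
    if "u \<noteq> (0, 0, 0)" for u
    using T0[OF that] ev image_proj_point[OF T] by metis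
  ultimately show ?thesis
    unfolding is_morphism_def by blast
qed

text \<open>With x' = (x - m) / s the cubic becomes s^3 (x'^3 - x'). Keeping y fixed and moving s^3
  to the left gives the coefficient \<open>inverse (s ^ 3)\<close> and needs no square root of
  s.\<close>

lemma symmetric_cubic_isomorphic:
  fixes m s :: "'a::field"
  assumes s: "s \<noteq> 0"
  shows "ell_isomorphic 1 ([:- m, 1:] * [:- (m + s), 1:] * [:- (m - s), 1:])
    (inverse (s ^ 3)) [:0, -1, 0, 1:]"
proof -
  define f g where "f = [:- m, 1:] * [:- (m + s), 1:] * [:- (m - s), 1:]"
    and "g = [:0, -1, 0, 1 :: 'a:]"
  define k where "k = inverse (s ^ 3)"
  define M \<sigma> where "M = to_ac m" and "\<sigma> = to_ac s"
  have \<sigma>: "\<sigma> \<noteq> 0"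
    using s by (simp add: \<sigma>_def)
  \<comment> \<open>Homogeneous form of x' = (x - m) / s, y' = y, with the denominator s cleared;
    \<open>U\<close> is its inverse.\<close>
  define T where "T = (\<lambda>(x, y, z). (x - M * z, \<sigma> * y, \<sigma> * z))"
  define U where "U = (\<lambda>(x, y, z). (x + M / \<sigma> * z, y / \<sigma>, z / \<sigma>))"
  have T: "T (x, y, z) = (to_ac 1 * x + to_ac (- m) * z, to_ac s * y, to_ac s * z)" for x y z
    by (simp add: T_def M_def \<sigma>_def)
  have U: "U (x, y, z) = (to_ac 1 * x + to_ac (m / s) * z, to_ac (inverse s) * y, to_ac (inverse s) * z)"
    for x y z
    by (simp add: U_def M_def \<sigma>_def field_simps)
  have UT: "U (T v) = v" and TU: "T (U v) = v" for v
    using \<sigma> by (cases v; simp add: T_def U_def)+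
  \<comment> \<open>As an equivalence this serves both directions: for \<open>U\<close>, apply it at
    \<open>U v\<close> and use \<open>TU\<close>.\<close>
  have cone: "on_cone 1 f v \<longleftrightarrow> on_cone k g (T v)" for v
  proof (cases v)
    case (fields x y z)
    have "to_ac k * (\<sigma> * y) ^ 2 * (\<sigma> * z) = y ^ 2 * z"
      using \<sigma> by (simp add: k_def \<sigma>_def eval_nat_numeral field_simps)
    moreover have "(\<Sum>i\<le>3. to_ac (Polynomial.coeff f i) * x ^ i * z ^ (3 - i)) =
        (x - M * z) * ((x - M * z) ^ 2 - (\<sigma> * z) ^ 2)"
      unfolding f_def by (simp add: eval_nat_numeral M_def \<sigma>_def algebra_simps)
    moreover have "(\<Sum>i\<le>3. to_ac (Polynomial.coeff g i) * x' ^ i * z' ^ (3 - i)) =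
        x' * (x' ^ 2 - z' ^ 2)" for x' z'
      unfolding g_def by (simp add: eval_nat_numeral algebra_simps)
    ultimately show ?thesis
      by (simp only: fields on_cone_def T_def prod.case to_ac_1 mult_1_left)
  qed
  have "is_morphism (curve 1 f) (curve k g) (image T)"
    by (rule is_morphism_curve[OF T]) (use s cone in simp_all)
  moreover have "is_morphism (curve k g) (curve 1 f) (image U)"
    by (rule is_morphism_curve[OF U]) (use s cone TU in simp_all)
  moreover have "U ` T ` P = P" "T ` U ` P = P" for P
    by (simp_all add: image_image UT TU)
  moreover have "T ` point_at_infinity = point_at_infinity"
  proof -
    \<comment> \<open>Rescaling by \<sigma> shows that (0, \<sigma>, 0) and (0, 1, 0) represent the
      same point.\<close>
    have "\<exists>c'. c' \<noteq> 0 \<and> c = c' * \<sigma>" if "c \<noteq> 0" for c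
      using \<sigma> that by (intro exI[of _ "c / \<sigma>"]) simp
    then have "proj_point (0, \<sigma>, 0) = proj_point (0, 1, 0)"
      unfolding proj_point_def using \<sigma> by auto
    then show ?thesis
      unfolding point_at_infinity_def image_proj_point[OF T] by (simp add: T_def)
  qed
  ultimately show ?thesis
    unfolding ell_isomorphic_def f_def[symmetric] g_def[symmetric] k_def[symmetric] by blast
qed

section \<open>The equivalences and the isomorphism\<close>

theorem theorem2p16:
  fixes A F G f :: "'a::{field, finite} poly"
    and \<gamma> :: 'a
    and p k q :: nat
  assumes "prime p" and "odd p" and "k > 0" and "q = p ^ k" and "card (UNIV :: 'a set) = q"
    and "squarefree A" and "odd (Polynomial.degree A)" and "Polynomial.degree A > 1"
    and "splits_completely A"
    and "pderiv A = [:\<gamma>:]" and "\<gamma> \<noteq> 0"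
    and "Polynomial.lead_coeff f = 1" and "Polynomial.degree f = 3" and "distinct_roots f"
    and "A * G ^ 2 = pcompose f F"
    and "pderiv F \<noteq> 0"
  defines "condA \<equiv> 2 * int (Polynomial.degree F) \<le> int (Polynomial.degree A) - 1"
    and "condB \<equiv> 2 * int (Polynomial.degree G) \<le> int (Polynomial.degree F) - 1"
    and "condC \<equiv> \<exists>\<beta>. \<beta> \<noteq> 0 \<and> G ^ 2 = Polynomial.smult \<beta> (pderiv F)"
  shows "(condA \<longleftrightarrow> condB) \<and> (condB \<longleftrightarrow> condC) \<and>
    (condA \<or> condB \<or> condC \<longrightarrow> (\<exists>a. a \<noteq> 0 \<and> ell_isomorphic 1 f a [:0, -1, 0, 1:]))"
proof -
  have F0: "pcompose f F \<noteq> 0"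
    using assms(13) degree_less_if_pderiv_neq_0[OF assms(16)] degree_pcompose[of f F] by auto
  then have "A \<noteq> 0" "G \<noteq> 0"
    using assms(15) by auto
  then have degs: "Polynomial.degree A + 2 * Polynomial.degree G = 3 * Polynomial.degree F"
    using assms(13,15) degree_pcompose[of f F]
    by (metis degree_mult_eq degree_power_eq power_not_zero)
  \<comment> \<open>Substituting deg A = 3 deg F - 2 deg G into (A) yields (B) literally.\<close>
  then have AB: "condA \<longleftrightarrow> condB"
    unfolding condA_def condB_def by linarith
  have CB: "condB" if C: "condC"
  proof -
    obtain \<beta> where "\<beta> \<noteq> 0" "G ^ 2 = Polynomial.smult \<beta> (pderiv F)"
      using C unfolding condC_def by blast
    then have "2 * Polynomial.degree G = Polynomial.degree (pderiv F)"
      using degree_power_eq[OF \<open>G \<noteq> 0\<close>, of 2] by simp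
    then show ?thesis
      unfolding condB_def using degree_less_if_pderiv_neq_0[OF assms(16)] by linarith
  qed
  have "condC \<and> (\<exists>a. a \<noteq> 0 \<and> ell_isomorphic 1 f a [:0, -1, 0, 1:])" if A: "condA"
  proof -
    have "2 * Polynomial.degree F < Polynomial.degree A"
      using A unfolding condA_def by linarith
    then obtain \<beta> m s where *: "\<beta> \<noteq> 0" "G ^ 2 = Polynomial.smult \<beta> (pderiv F)" "s \<noteq> 0"
      "f = [:- m, 1:] * [:- (m + s), 1:] * [:- (m - s), 1:]"
      using square_eq_smult_pderiv_and_symmetric_cubic[OF card_roots_eq_degree[OF assms(9,6)] assms(10,11,12,13,15,16)]
      by blast
    have "ell_isomorphic 1 f (inverse (s ^ 3)) [:0, -1, 0, 1:]"
      unfolding *(4) using *(3) by (rule symmetric_cubic_isomorphic)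
    moreover have "inverse (s ^ 3) \<noteq> 0"
      using *(3) by simp
    ultimately show ?thesis
      using * unfolding condC_def by blast
  qed
  then show ?thesis
    using AB CB by blast
qed

end
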